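(* Let $t\ge2$ be an integer and $c_t=2^{4\lfloor t/2\rfloor}-1$. Then $$\rho(A_{2^t})\ge c_t-1=2^{4\lfloor t/2\rfloor}-2\qquad\text{and}\qquad |E(G_{2^t})|\ge\binom{c_t}{2}.$$
   Context: For $n\ge2$, $\mathbb{L}_n=\{a+bi+cj+dk: a,b,c,d\in\mathbb{Z}/n\mathbb{Z}\}$ is the ring of Lipschitz quaternions modulo $n$, with the usual relations $i^2=j^2=k^2=-1$, $ij=k=-ji$, $jk=i=-kj$, $ki=j=-ik$ taken modulo $n$. A nonzero element $x$ of a ring is a zero divisor if $xy=0$ or $yx=0$ for some nonzero $y$. $G_n=\Gamma(\mathbb{L}_n)$ is the simple undirected graph whose vertices are the nonzero zero divisors of $\mathbb{L}_n$, distinct $x,y$ being adjacent iff $xy=0$ or $yx=0$; $A_n=A(G_n)$ is its adjacency matrix. $\rho$ denotes the spectral radius. *)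

theory Defs
  imports "Jordan_Normal_Form.Spectral_Radius" "HOL-Algebra.Ring"
begin

text \<open>The quadruple \<open>(a, b, c, d)\<close> with entries in \<open>{0..<n}\<close> stands for \<open>a + bi + cj + dk\<close>.\<close>

definition lipschitz :: "nat \<Rightarrow> (int \<times> int \<times> int \<times> int) ring" where
  "lipschitz n =
    \<lparr>carrier = {0..<int n} \<times> {0..<int n} \<times> {0..<int n} \<times> {0..<int n},
     monoid.mult = (\<lambda>(a, b, c, d) (a', b', c', d').
       ((a * a' - b * b' - c * c' - d * d') mod int n,
        (a * b' + b * a' + c * d' - d * c') mod int n,
        (a * c' - b * d' + c * a' + d * b') mod int n,
        (a * d' + b * c' - c * b' + d * a') mod int n)),
     one = (1 mod int n, 0, 0, 0),
     zero = (0, 0, 0, 0),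
     add = (\<lambda>(a, b, c, d) (a', b', c', d').
       ((a + a') mod int n, (b + b') mod int n, (c + c') mod int n, (d + d') mod int n))\<rparr>"

definition zero_divisors :: "('a, 'm) ring_scheme \<Rightarrow> 'a set" where
  "zero_divisors R =
    {x \<in> carrier R - {\<zero>\<^bsub>R\<^esub>}. \<exists>y \<in> carrier R - {\<zero>\<^bsub>R\<^esub>}.
       x \<otimes>\<^bsub>R\<^esub> y = \<zero>\<^bsub>R\<^esub> \<or> y \<otimes>\<^bsub>R\<^esub> x = \<zero>\<^bsub>R\<^esub>}"

text \<open>The zero divisor graph of \<open>R\<close> has vertex set \<^term>\<open>zero_divisors R\<close>; its edges are
  two-element sets of vertices, so each undirected edge is counted once.\<close>

definition zero_divisor_edges :: "('a, 'm) ring_scheme \<Rightarrow> 'a set set" where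
  "zero_divisor_edges R =
    {{x, y} | x y. x \<in> zero_divisors R \<and> y \<in> zero_divisors R \<and> x \<noteq> y \<and>
       (x \<otimes>\<^bsub>R\<^esub> y = \<zero>\<^bsub>R\<^esub> \<or> y \<otimes>\<^bsub>R\<^esub> x = \<zero>\<^bsub>R\<^esub>)}"

text \<open>Rows and columns are indexed by an enumeration \<open>vs\<close> of the vertices without repetition.
  A diagonal entry is 0, since \<open>{vs ! i, vs ! i}\<close> is a singleton and hence not an edge.\<close>

definition adjacency_matrix :: "'a set set \<Rightarrow> 'a list \<Rightarrow> complex mat" where
  "adjacency_matrix E vs =
    mat (length vs) (length vs) (\<lambda>(i, j). if {vs ! i, vs ! j} \<in> E then 1 else 0)"

context
begin

private fun qmul :: "int \<times> int \<times> int \<times> int \<Rightarrow> int \<times> int \<times> int \<times> int \<Rightarrow> int \<times> int \<times> int \<times> int" where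
  "qmul (a, b, c, d) (a', b', c', d') =
    (a * a' - b * b' - c * c' - d * d',
     a * b' + b * a' + c * d' - d * c',
     a * c' - b * d' + c * a' + d * b',
     a * d' + b * c' - c * b' + d * a')"

private fun qadd :: "int \<times> int \<times> int \<times> int \<Rightarrow> int \<times> int \<times> int \<times> int \<Rightarrow> int \<times> int \<times> int \<times> int" where
  "qadd (a, b, c, d) (a', b', c', d') = (a + a', b + b', c + c', d + d')"

private fun red :: "nat \<Rightarrow> int \<times> int \<times> int \<times> int \<Rightarrow> int \<times> int \<times> int \<times> int" where
  "red n (a, b, c, d) = (a mod int n, b mod int n, c mod int n, d mod int n)"

private lemma red_qmul: "red n (qmul (red n x) y) = red n (qmul x y)"
    "red n (qmul x (red n y)) = red n (qmul x y)"
  by (cases x; cases y; simp; intro conjI mod_diff_cong mod_add_cong mod_mult_cong; simp)+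

private lemma red_qadd: "red n (qadd (red n x) y) = red n (qadd x y)"
    "red n (qadd x (red n y)) = red n (qadd x y)"
  by (cases x; cases y; simp add: mod_simps)+

private lemma q_laws:
  "qadd (qadd x y) z = qadd x (qadd y z)"
  "qmul (qmul x y) z = qmul x (qmul y z)"
  "qmul (qadd x y) z = qadd (qmul x z) (qmul y z)"
  "qmul z (qadd x y) = qadd (qmul z x) (qmul z y)"
  by (cases x; cases y; cases z; simp add: algebra_simps)+

private lemma qadd_commute: "qadd x y = qadd y x"
  by (cases x; cases y) simp

private lemma lipschitz_ops:
  "x \<otimes>\<^bsub>lipschitz n\<^esub> y = red n (qmul x y)" "x \<oplus>\<^bsub>lipschitz n\<^esub> y = red n (qadd x y)"
  by (cases x; cases y; simp add: lipschitz_def)+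

private lemma red_carrier: "n \<ge> 2 \<Longrightarrow> red n x \<in> carrier (lipschitz n)"
  by (cases x) (simp add: lipschitz_def)

lemma ring_lipschitz:
  assumes "n \<ge> 2"
  shows "ring (lipschitz n)"
proof -
  have n: "int n > 0" "1 mod int n = 1" using assms by auto
  have inv: "\<exists>y \<in> carrier (lipschitz n). y \<oplus>\<^bsub>lipschitz n\<^esub> x = \<zero>\<^bsub>lipschitz n\<^esub>"
    if "x \<in> carrier (lipschitz n)" for x
  proof -
    obtain a b c d where x: "x = (a, b, c, d)" by (cases x)
    show ?thesis
      by (rule bexI[of _ "((-a) mod int n, (-b) mod int n, (-c) mod int n, (-d) mod int n)"])
         (use n in \<open>auto simp: lipschitz_def x mod_simps\<close>)
  qed
  have unit: "\<zero>\<^bsub>lipschitz n\<^esub> \<in> carrier (lipschitz n)" "\<one>\<^bsub>lipschitz n\<^esub> \<in> carrier (lipschitz n)"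
    using assms by (auto simp: lipschitz_def)
  have neutral: "\<zero>\<^bsub>lipschitz n\<^esub> \<oplus>\<^bsub>lipschitz n\<^esub> x = x" "\<one>\<^bsub>lipschitz n\<^esub> \<otimes>\<^bsub>lipschitz n\<^esub> x = x"
    "x \<otimes>\<^bsub>lipschitz n\<^esub> \<one>\<^bsub>lipschitz n\<^esub> = x" if "x \<in> carrier (lipschitz n)" for x
    using that n by (auto simp: lipschitz_def)
  note laws = lipschitz_ops red_qmul red_qadd q_laws red_carrier[OF assms]
  show ?thesis
  proof (intro ringI abelian_groupI monoidI inv neutral unit; assumption?)
  qed (simp only: laws; fail | simp only: lipschitz_ops qadd_commute)+
qed

end

lemma i_j_k_lipschitz:
  assumes "n \<ge> 2"
  defines "m \<equiv> monoid.mult (lipschitz n)"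
    and "i \<equiv> (0, 1, 0, 0)" and "j \<equiv> (0, 0, 1, 0)" and "k \<equiv> (0, 0, 0, 1)"
  shows "i \<in> carrier (lipschitz n)" "j \<in> carrier (lipschitz n)" "k \<in> carrier (lipschitz n)"
    and "m i i = \<ominus>\<^bsub>lipschitz n\<^esub> \<one>\<^bsub>lipschitz n\<^esub>" "m j j = \<ominus>\<^bsub>lipschitz n\<^esub> \<one>\<^bsub>lipschitz n\<^esub>"
      "m k k = \<ominus>\<^bsub>lipschitz n\<^esub> \<one>\<^bsub>lipschitz n\<^esub>"
    and "m i j = k" "m j i = \<ominus>\<^bsub>lipschitz n\<^esub> k"
    and "m j k = i" "m k j = \<ominus>\<^bsub>lipschitz n\<^esub> i"
    and "m k i = j" "m i k = \<ominus>\<^bsub>lipschitz n\<^esub> j"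
proof -
  interpret ring "lipschitz n" by (rule ring_lipschitz) fact
  have n: "int n > 1" using assms(1) by simp
  have neg: "\<ominus>\<^bsub>lipschitz n\<^esub> (a, b, c, d) =
      ((-a) mod int n, (-b) mod int n, (-c) mod int n, (-d) mod int n)"
    if "(a, b, c, d) \<in> carrier (lipschitz n)" for a b c d
    by (rule minus_equality) (use that n in \<open>auto simp: lipschitz_def mod_simps\<close>)
  have one: "\<one>\<^bsub>lipschitz n\<^esub> = (1, 0, 0, 0)" using n by (simp add: lipschitz_def)
  have car: "(1, 0, 0, 0) \<in> carrier (lipschitz n)" "(0, 1, 0, 0) \<in> carrier (lipschitz n)"
    "(0, 0, 1, 0) \<in> carrier (lipschitz n)" "(0, 0, 0, 1) \<in> carrier (lipschitz n)"
    using n by (auto simp: lipschitz_def)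
  show "i \<in> carrier (lipschitz n)" "j \<in> carrier (lipschitz n)" "k \<in> carrier (lipschitz n)"
    using car by (simp_all add: i_def j_def k_def)
  note d = m_def i_def j_def k_def one neg[OF car(1)] neg[OF car(2)] neg[OF car(3)] neg[OF car(4)]
  show "m i i = \<ominus>\<^bsub>lipschitz n\<^esub> \<one>\<^bsub>lipschitz n\<^esub>" "m j j = \<ominus>\<^bsub>lipschitz n\<^esub> \<one>\<^bsub>lipschitz n\<^esub>"
      "m k k = \<ominus>\<^bsub>lipschitz n\<^esub> \<one>\<^bsub>lipschitz n\<^esub>"
    and "m i j = k" "m j i = \<ominus>\<^bsub>lipschitz n\<^esub> k"
    and "m j k = i" "m k j = \<ominus>\<^bsub>lipschitz n\<^esub> i"
    and "m k i = j" "m i k = \<ominus>\<^bsub>lipschitz n\<^esub> j"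
    unfolding d using n by (auto simp: lipschitz_def)
qed

lemma finite_zero_divisors_lipschitz: "finite (zero_divisors (lipschitz n))"
  by (rule finite_subset[of _ "carrier (lipschitz n)"]) (auto simp: zero_divisors_def lipschitz_def)

lemma finite_zero_divisor_edges_lipschitz: "finite (zero_divisor_edges (lipschitz n))"
  by (rule finite_subset[of _ "Pow (zero_divisors (lipschitz n))"])
     (auto simp: zero_divisor_edges_def finite_zero_divisors_lipschitz)

end

theory Submission imports Defs begin

text \<open>
  Write \<open>2 ^ t = m * l\<close> with \<open>l = 2 ^ (t div 2)\<close>, so that \<open>l\<close> divides \<open>m\<close>. The quaternions
  modulo \<open>m * l\<close> with all four coordinates divisible by \<open>m\<close> form an ideal of size \<open>l ^ 4\<close>
  whose square vanishes, because a product of two of its elements has coordinates divisible by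
  \<open>m * m\<close> and hence by \<open>m * l\<close>. Its nonzero elements are therefore zero divisors (each
  annihilates itself) and pairwise adjacent: they form a clique of \<open>c\<close> vertices
  (\<open>clique_multiples\<close>).

  A clique of \<open>c\<close> vertices contains \<open>c choose 2\<close> edges. For the spectral radius, each row of
  the adjacency matrix that belongs to the clique has at least \<open>c - 1\<close> ones in the columns of
  the clique, and this forces a spectral radius of at least \<open>c - 1\<close>. The last step
  (\<open>spectral_radius_ge_row_sums\<close>) is the easy half of Perron--Frobenius theory and holds for
  all nonnegative matrices: within a set of rows and columns where all row sums are at least
  \<open>r\<close>, the row sums of the \<open>k\<close>-th power are at least \<open>r ^ k\<close>, whereas the powers of a matrix of
  spectral radius below \<open>s\<close> are \<open>O(s ^ k)\<close> by the Jordan normal form.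
\<close>

section \<open>Spectral radius of nonnegative matrices\<close>

lemma pow_mat_nonneg:
  fixes R :: "real mat"
  assumes R: "R \<in> carrier_mat n n"
    and nonneg: "\<And>i j. i < n \<Longrightarrow> j < n \<Longrightarrow> R $$ (i, j) \<ge> 0"
    and "i < n" "j < n"
  shows "(R ^\<^sub>m k) $$ (i, j) \<ge> 0"
  using \<open>i < n\<close> \<open>j < n\<close>
proof (induction k arbitrary: i j)
  case 0
  then show ?case using R by simp
next
  case (Suc k)
  have "R ^\<^sub>m k \<in> carrier_mat n n" using R by simp
  then show ?case
    using Suc R by (auto simp: scalar_prod_def intro!: sum_nonneg mult_nonneg_nonneg nonneg)
qed

text \<open>Entries outside \<open>S\<close> only contribute nonnegative terms, so that the row sums over \<open>S\<close> are
  supermultiplicative.\<close>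

lemma row_sum_pow_mat_ge:
  fixes R :: "real mat"
  assumes R: "R \<in> carrier_mat n n"
    and nonneg: "\<And>i j. i < n \<Longrightarrow> j < n \<Longrightarrow> R $$ (i, j) \<ge> 0"
    and S: "S \<subseteq> {..<n}"
    and row: "\<And>i. i \<in> S \<Longrightarrow> (\<Sum>j\<in>S. R $$ (i, j)) \<ge> r"
    and r: "r \<ge> 0" and i: "i \<in> S"
  shows "(\<Sum>j\<in>S. (R ^\<^sub>m k) $$ (i, j)) \<ge> r ^ k"
proof (induction k)
  case 0
  have "finite S" using S finite_subset by blast
  have "(\<Sum>j\<in>S. (R ^\<^sub>m 0) $$ (i, j)) = (\<Sum>j\<in>S. if i = j then 1 else 0)"
    using S i R by (intro sum.cong) (auto simp: subset_iff)
  then show ?case using i \<open>finite S\<close> by simp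
next
  case (Suc k)
  have P: "R ^\<^sub>m k \<in> carrier_mat n n" using R by simp
  have pos: "(R ^\<^sub>m k) $$ (i, l) \<ge> 0" if "l < n" for l
    using pow_mat_nonneg[OF R nonneg] that i S by auto
  have "r ^ Suc k \<le> (\<Sum>l\<in>S. (R ^\<^sub>m k) $$ (i, l)) * r"
    using Suc r by (simp add: mult.commute mult_left_mono)
  also have "\<dots> \<le> (\<Sum>l\<in>S. (R ^\<^sub>m k) $$ (i, l) * (\<Sum>j\<in>S. R $$ (l, j)))"
    unfolding sum_distrib_right using S by (intro sum_mono mult_left_mono row pos) auto
  also have "\<dots> = (\<Sum>j\<in>S. \<Sum>l\<in>S. (R ^\<^sub>m k) $$ (i, l) * R $$ (l, j))"
    unfolding sum_distrib_left by (rule sum.swap)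
  also have "\<dots> \<le> (\<Sum>j\<in>S. \<Sum>l<n. (R ^\<^sub>m k) $$ (i, l) * R $$ (l, j))"
    using S by (intro sum_mono sum_mono2) (auto intro!: mult_nonneg_nonneg pos nonneg)
  also have "\<dots> = (\<Sum>j\<in>S. (R ^\<^sub>m Suc k) $$ (i, j))"
    using P R S i by (intro sum.cong) (auto simp: scalar_prod_def lessThan_atLeast0 subset_iff)
  finally show ?case .
qed

text \<open>The case of row sums above 1: were the spectral radius below 1, the powers would stay
  bounded, but their row sums grow geometrically.\<close>

lemma spectral_radius_ge_1:
  fixes R :: "real mat"
  assumes R: "R \<in> carrier_mat n n"
    and nonneg: "\<And>i j. i < n \<Longrightarrow> j < n \<Longrightarrow> R $$ (i, j) \<ge> 0"
    and S: "S \<subseteq> {..<n}" "S \<noteq> {}"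
    and row: "\<And>i. i \<in> S \<Longrightarrow> (\<Sum>j\<in>S. R $$ (i, j)) \<ge> q"
    and q: "q > 1"
  shows "spectral_radius (map_mat complex_of_real R) \<ge> 1"
proof (rule ccontr)
  let ?A = "map_mat complex_of_real R"
  assume "\<not> ?thesis"
  then obtain b where b: "\<And>k. norm_bound (?A ^\<^sub>m k) b"
    using spectral_radius_jnf_norm_bound_less_1_upper_triangular[of ?A n] R by auto
  obtain i where i: "i \<in> S" using S by blast
  have bound: "(R ^\<^sub>m k) $$ (i, j) \<le> b" if "j \<in> S" for j k
  proof -
    have ij: "i < n" "j < n" using that i S by auto
    have P: "R ^\<^sub>m k \<in> carrier_mat n n" using R by simp
    have "?A ^\<^sub>m k = map_mat complex_of_real (R ^\<^sub>m k)"
      by (rule of_real_hom.mat_hom_pow[OF R, symmetric])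
    then have "norm (complex_of_real ((R ^\<^sub>m k) $$ (i, j))) \<le> b"
      using b[of k] ij P unfolding norm_bound_def by (metis carrier_matD index_map_mat)
    then show ?thesis by simp
  qed
  obtain k where k: "q ^ k > real (card S) * b"
    using real_arch_pow[OF q] by blast
  have "q ^ k \<le> (\<Sum>j\<in>S. (R ^\<^sub>m k) $$ (i, j))"
    using row_sum_pow_mat_ge[OF R nonneg S(1) row _ i] q by simp
  also have "\<dots> \<le> real (card S) * b"
    using bound by (rule sum_bounded_above)
  finally show False using k by simp
qed

text \<open>The general bound follows by scaling: if the spectral radius were below \<open>r\<close>, dividing by a
  number \<open>s\<close> strictly between them would give row sums above 1 and a spectral radius below 1.\<close>

theorem spectral_radius_ge_row_sums:
  fixes R :: "real mat"
  assumes R: "R \<in> carrier_mat n n"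
    and nonneg: "\<And>i j. i < n \<Longrightarrow> j < n \<Longrightarrow> R $$ (i, j) \<ge> 0"
    and S: "S \<subseteq> {..<n}" "S \<noteq> {}"
    and row: "\<And>i. i \<in> S \<Longrightarrow> (\<Sum>j\<in>S. R $$ (i, j)) \<ge> r"
  shows "spectral_radius (map_mat complex_of_real R) \<ge> r"
proof (rule ccontr)
  let ?A = "map_mat complex_of_real R"
  assume "\<not> ?thesis"
  then obtain s where s: "spectral_radius ?A < s" "s < r"
    using dense[of "spectral_radius ?A" r] by auto
  have n: "n > 0" using S by auto
  have A: "?A \<in> carrier_mat n n" using R by simp
  have "spectral_radius ?A \<ge> 0" using spectral_radius_mem_max(1)[OF A n] by auto
  then have s0: "s > 0" using s by simp
  define M where "M = (1 / s) \<cdot>\<^sub>m R"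
  let ?B = "map_mat complex_of_real M"
  have M: "M \<in> carrier_mat n n" and B: "?B \<in> carrier_mat n n"
    using R by (simp_all add: M_def)
  have "spectral_radius ?B \<ge> 1"
  proof (rule spectral_radius_ge_1[OF M _ S, where q = "r / s"])
    show "M $$ (i, j) \<ge> 0" if "i < n" "j < n" for i j
      using that nonneg[OF that] R s0 by (auto simp: M_def)
    show "(\<Sum>j\<in>S. M $$ (i, j)) \<ge> r / s" if "i \<in> S" for i
    proof -
      have "(\<Sum>j\<in>S. M $$ (i, j)) = (\<Sum>j\<in>S. R $$ (i, j) / s)"
        using R S that by (intro sum.cong) (auto simp: M_def subset_iff)
      also have "\<dots> = (\<Sum>j\<in>S. R $$ (i, j)) / s" by (rule sum_divide_distrib[symmetric])
      finally show ?thesis using row[OF that] s0 by (simp add: divide_right_mono)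
    qed
    show "r / s > 1" using s s0 by simp
  qed
  moreover obtain e where e: "e \<in> spectrum ?B" "spectral_radius ?B = norm e"
    using spectral_radius_mem_max(1)[OF B n] by auto
  moreover have "complex_of_real s * e \<in> spectrum ?A"
  proof -
    obtain v where v: "v \<in> carrier_vec n" "v \<noteq> 0\<^sub>v n" "?B *\<^sub>v v = e \<cdot>\<^sub>v v"
      using e(1) B unfolding spectrum_def eigenvalue_def eigenvector_def by auto
    have "?A = complex_of_real s \<cdot>\<^sub>m ?B"
      using s0 R by (intro eq_matI) (auto simp: M_def)
    then have "?A *\<^sub>v v = complex_of_real s \<cdot>\<^sub>v (?B *\<^sub>v v)"
      using v(1) B by (auto simp: scalar_prod_def sum_distrib_left mult.assoc intro!: eq_vecI)
    then have "?A *\<^sub>v v = (complex_of_real s * e) \<cdot>\<^sub>v v"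
      using v by (simp add: smult_smult_assoc)
    then show ?thesis
      using v A unfolding spectrum_def eigenvalue_def eigenvector_def by auto
  qed
  then have "norm (complex_of_real s * e) \<le> spectral_radius ?A"
    using spectral_radius_mem_max(2)[OF A n] by blast
  ultimately have "s \<le> spectral_radius ?A"
    using s0 order_trans[of s "s * norm e"] by (simp add: norm_mult)
  then show False using s by simp
qed

section \<open>Cliques\<close>

lemma spectral_radius_ge_clique:
  assumes vs: "distinct vs" and K: "K \<subseteq> set vs" "K \<noteq> {}"
    and clique: "\<And>x y. x \<in> K \<Longrightarrow> y \<in> K \<Longrightarrow> x \<noteq> y \<Longrightarrow> {x, y} \<in> E"
  shows "spectral_radius (adjacency_matrix E vs) \<ge> real (card K) - 1"
proof -
  let ?n = "length vs"
  define R :: "real mat" where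
    "R = mat ?n ?n (\<lambda>(i, j). if {vs ! i, vs ! j} \<in> E then 1 else 0)"
  define S where "S = {i. i < ?n \<and> vs ! i \<in> K}"
  have A: "adjacency_matrix E vs = map_mat complex_of_real R"
    unfolding adjacency_matrix_def R_def by (rule eq_matI) auto
  have img: "(!) vs ` S = K" using K(1) by (force simp: S_def in_set_conv_nth)
  have inj: "inj_on ((!) vs) S" using vs by (auto simp: S_def inj_on_def nth_eq_iff_index_eq)
  have card: "card S = card K" using card_image[OF inj] img by simp
  have S: "S \<subseteq> {..<?n}" "S \<noteq> {}" using img K(2) by (auto simp: S_def)
  have "finite S" by (simp add: S_def)
  show ?thesis unfolding A
  proof (rule spectral_radius_ge_row_sums[OF _ _ S])
    show "R \<in> carrier_mat ?n ?n" by (simp add: R_def)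
    show "R $$ (i, j) \<ge> 0" if "i < ?n" "j < ?n" for i j
      using that by (simp add: R_def)
    show "(\<Sum>j\<in>S. R $$ (i, j)) \<ge> real (card K) - 1" if i: "i \<in> S" for i
    proof -
      have entry: "R $$ (i, j) = 1" if "j \<in> S - {i}" for j
        using that i vs clique[of "vs ! i" "vs ! j"]
        by (auto simp: R_def S_def nth_eq_iff_index_eq)
      have "real (card K) - 1 = real (card (S - {i}))"
        using card.remove[OF \<open>finite S\<close> i] card by simp
      also have "\<dots> = (\<Sum>j\<in>S - {i}. R $$ (i, j))" using entry by simp
      also have "\<dots> \<le> (\<Sum>j\<in>S. R $$ (i, j))"
        using \<open>finite S\<close> i by (intro sum_mono2) (auto simp: R_def S_def)
      finally show ?thesis .
    qed
  qed
qed

lemma card_edges_ge_clique: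
  assumes "finite E" "finite K"
    and clique: "\<And>x y. x \<in> K \<Longrightarrow> y \<in> K \<Longrightarrow> x \<noteq> y \<Longrightarrow> {x, y} \<in> E"
  shows "card E \<ge> card K choose 2"
proof -
  have "{e. e \<subseteq> K \<and> card e = 2} \<subseteq> E"
    using clique by (auto simp: card_2_iff)
  then have "card {e. e \<subseteq> K \<and> card e = 2} \<le> card E"
    by (rule card_mono[OF \<open>finite E\<close>])
  then show ?thesis using n_subsets[OF \<open>finite K\<close>] by simp
qed

section \<open>A square-zero ideal of quaternions\<close>

definition multiples :: "nat \<Rightarrow> nat \<Rightarrow> int set" where
  "multiples m l = (\<lambda>a. int m * a) ` {0..<int l}"

definition nonzero_multiples :: "nat \<Rightarrow> nat \<Rightarrow> (int \<times> int \<times> int \<times> int) set" where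
  "nonzero_multiples m l =
    multiples m l \<times> multiples m l \<times> multiples m l \<times> multiples m l - {(0, 0, 0, 0)}"

lemma card_nonzero_multiples:
  assumes "m > 0" "l > 0"
  shows "finite (nonzero_multiples m l)" "card (nonzero_multiples m l) = l ^ 4 - 1"
proof -
  have fin: "finite (multiples m l)" by (simp add: multiples_def)
  then show "finite (nonzero_multiples m l)" by (simp add: nonzero_multiples_def)
  have "card (multiples m l) = l"
    using assms unfolding multiples_def by (subst card_image) (auto simp: inj_on_def)
  moreover have "0 \<in> multiples m l" using assms by (force simp: multiples_def)
  ultimately show "card (nonzero_multiples m l) = l ^ 4 - 1"
    using fin by (simp add: nonzero_multiples_def card_cartesian_product eval_nat_numeral
        card_Diff_singleton)
qed

lemma nonzero_multiples_subset_carrier: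
  assumes "m > 0"
  shows "nonzero_multiples m l \<subseteq> carrier (lipschitz (m * l)) - {\<zero>\<^bsub>lipschitz (m * l)\<^esub>}"
  using assms by (auto simp: nonzero_multiples_def multiples_def lipschitz_def)

text \<open>Each coordinate of a product is a combination of products of two multiples of \<open>m\<close>, and
  \<open>m * l\<close> divides \<open>m * m\<close>.\<close>

lemma mult_nonzero_multiples:
  assumes "l dvd m" and x: "x \<in> nonzero_multiples m l" and y: "y \<in> nonzero_multiples m l"
  shows "x \<otimes>\<^bsub>lipschitz (m * l)\<^esub> y = \<zero>\<^bsub>lipschitz (m * l)\<^esub>"
proof -
  have dvd: "int m * int l dvd a * b" if "a \<in> multiples m l" "b \<in> multiples m l" for a b
  proof -
    have "int m * int l dvd int m * int m" using assms(1) by (simp add: mult_dvd_mono)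
    also have "int m * int m dvd a * b"
      using that by (auto simp: multiples_def intro: mult_dvd_mono)
    finally show ?thesis .
  qed
  show ?thesis
    using x y by (auto simp: nonzero_multiples_def lipschitz_def intro!: dvd_imp_mod_0 dvd_add dvd_diff dvd)
qed

lemma nonzero_multiples_zero_divisors:
  assumes "m > 0" "l dvd m"
  shows "nonzero_multiples m l \<subseteq> zero_divisors (lipschitz (m * l))"
  using nonzero_multiples_subset_carrier[OF assms(1), of l] mult_nonzero_multiples[OF assms(2)]
  unfolding zero_divisors_def by blast

lemma clique_multiples:
  assumes "m > 0" "l dvd m" "x \<in> nonzero_multiples m l" "y \<in> nonzero_multiples m l" "x \<noteq> y"
  shows "{x, y} \<in> zero_divisor_edges (lipschitz (m * l))"
  using nonzero_multiples_zero_divisors[OF assms(1,2)] mult_nonzero_multiples[OF assms(2-4)] assms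
  unfolding zero_divisor_edges_def by blast

section \<open>The bounds modulo a power of two\<close>

theorem corollary5p4:
  fixes t c :: nat
  assumes t: "t \<ge> 2"
    and c: "c = 2 ^ (4 * (t div 2)) - 1"
  shows "(\<forall>vs. distinct vs \<and> set vs = zero_divisors (lipschitz (2 ^ t)) \<longrightarrow>
             spectral_radius (adjacency_matrix (zero_divisor_edges (lipschitz (2 ^ t))) vs)
               \<ge> real c - 1)
         \<and> real c - 1 = 2 ^ (4 * (t div 2)) - 2
         \<and> card (zero_divisor_edges (lipschitz (2 ^ t))) \<ge> c choose 2"
proof -
  define l m :: nat where "l = 2 ^ (t div 2)" and "m = 2 ^ (t - t div 2)"
  let ?K = "nonzero_multiples m l"
  have n: "2 ^ t = m * l" by (simp add: l_def m_def flip: power_add)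
  have dvd: "l dvd m" unfolding l_def m_def by (rule le_imp_power_dvd) simp
  have pos: "m > 0" "l > 0" by (simp_all add: l_def m_def)
  have c_eq: "card ?K = c"
    using card_nonzero_multiples[OF pos] by (simp add: c l_def mult.commute flip: power_mult)
  have "(2::nat) ^ 1 \<le> 2 ^ (4 * (t div 2))"
    using t by (intro power_increasing) auto
  then have c_pos: "c > 0" and c_real: "real c - 1 = 2 ^ (4 * (t div 2)) - 2"
    by (simp_all add: c of_nat_diff)
  have "?K \<noteq> {}" using c_eq c_pos by auto
  then show ?thesis
    using spectral_radius_ge_clique[of _ ?K, OF _ _ _ clique_multiples[OF pos(1) dvd]]
      nonzero_multiples_zero_divisors[OF pos(1) dvd]
      card_edges_ge_clique[OF finite_zero_divisor_edges_lipschitz card_nonzero_multiples(1)[OF pos]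
        clique_multiples[OF pos(1) dvd]]
    unfolding n c_eq by (simp add: c_real)
qed

end
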